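(* For any fixed integer $k\ge2$ and positive constant $\alpha$, as $n\to\infty$, $$\mathbb{P}\big[\mathbf{C}_{n,p}\text{ contains a run of }k\text{ equal terms}\big]\to\begin{cases}1,&\text{if } 1\gg q\gg n^{-1/(k-1)},\\ 1-e^{-\alpha^{k-1}/k},&\text{if } q\sim\alpha n^{-1/(k-1)},\\ 0,&\text{if } n^{-1/(k-1)}\gg q.\end{cases}$$
   Context: An $n$-composition is a sequence of $n$ nonnegative integers. For $p=p(n)\in[0,1)$ and $q=1-p$, the geometric random composition $\mathbf{C}_{n,p}$ is the random $n$-composition whose terms are independent, with $\mathbb{P}[\mathbf{C}_{n,p}(i)=j]=qp^j$ for every $j\ge0$ and $i\in\{1,\dots,n\}$. A composition contains a run of $k$ equal terms if there are $k$ consecutive terms all equal to one another (possibly all zero; the run need not be maximal). For positive functions of $n$: $f\ll g$ (or $g\gg f$) means $\lim_{n\to\infty} f/g=0$, and $f\sim g$ means $\lim_{n\to\infty} f/g=1$. *)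

theory Defs
  imports "HOL-Probability.Probability"
begin

text \<open>
  An \<open>n\<close>-composition is represented by a function on \<open>{1..n}\<close>; the values outside
  this range are irrelevant. In the library, \<^term>\<open>geometric_pmf q\<close> is parameterised by the
  success probability, i.e.\ it assigns \<open>(1 - q) ^ j * q\<close> to \<open>j\<close>. It therefore has to be
  instantiated with \<open>q = 1 - p\<close>.
\<close>

definition geometric_composition :: "nat \<Rightarrow> real \<Rightarrow> (nat \<Rightarrow> nat) pmf" where
  "geometric_composition n p = Pi_pmf {1..n} 0 (\<lambda>_. geometric_pmf (1 - p))"

text \<open>The \<open>k\<close> consecutive positions \<open>i, \<dots>, i + k - 1\<close> have to lie within \<open>{1..n}\<close>.\<close>

definition contains_run :: "nat \<Rightarrow> nat \<Rightarrow> (nat \<Rightarrow> nat) \<Rightarrow> bool" where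
  "contains_run n k c \<longleftrightarrow> (\<exists>i. {i..<i + k} \<subseteq> {1..n} \<and> (\<forall>j\<in>{i..<i + k}. c j = c i))"

definition asymp_less :: "(nat \<Rightarrow> real) \<Rightarrow> (nat \<Rightarrow> real) \<Rightarrow> bool" where
  "asymp_less f g \<longleftrightarrow> (\<lambda>n. f n / g n) \<longlonglongrightarrow> 0"

definition asymp_sim :: "(nat \<Rightarrow> real) \<Rightarrow> (nat \<Rightarrow> real) \<Rightarrow> bool" where
  "asymp_sim f g \<longleftrightarrow> (\<lambda>n. f n / g n) \<longlonglongrightarrow> 1"

end

theory Submission
  imports Defs
begin

text \<open>
  Why the theorem holds. Let \<open>r\<close> be the probability that \<open>k\<close> given consecutive terms agree.
  Scan the composition from left to right and let \<open>u m\<close> be the probability that the first \<open>m\<close>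
  terms contain no run. The drop \<open>u m - u (m + 1)\<close> is the probability that the first run is
  completed by term \<open>m + 1\<close>. If the window ending there were independent of the absence of earlier
  runs, the drop would be \<open>r * u m\<close>, and \<open>u n\<close> would be \<open>(1 - r) ^ n\<close>. It nearly is:
  the window is independent of the terms before it, and an earlier run that uses terms of the
  window also uses the term just before it, so all \<open>k + 1\<close> terms agree. This extra agreement
  costs another factor of at most \<open>q\<close>, the largest probability of a single value. Independence
  produces \<open>u (m + 1 - k)\<close> instead of \<open>u m\<close>, but these differ by at most \<open>k * r\<close>. So each step
  has an error of at most \<open>r\<close> times \<open>q + k * r\<close>. Because the recursion contracts by \<open>1 - r\<close>, the
  accumulated error is at most \<open>q + k * r\<close>, no matter how large \<open>n\<close> is
  (\<open>prob_no_run_approx\<close>).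

  For the geometric distribution \<open>r = q ^ (k - 1) / (\<Sum>i<k. (1 - q) ^ i)\<close>
  (\<open>coincidence_geometric\<close>), so \<open>r \<le> q\<close>, and \<open>r\<close> behaves like \<open>q ^ (k - 1) / k\<close> as \<open>q\<close> tends
  to 0. In each of the three regimes \<open>q\<close> does tend to 0, the error vanishes, and the limit is
  decided by \<open>(1 - r) ^ n\<close>, that is, by the limit of \<open>n * r\<close>: infinite, \<open>\<alpha> ^ (k - 1) / k\<close>, or 0.
\<close>

section \<open>Independence and coincidences in i.i.d. families\<close>

lemma prob_pair_pmf_Times:
  "measure_pmf.prob (pair_pmf M N) (A \<times> B) = measure_pmf.prob M A * measure_pmf.prob N B"
proof -
  have "emeasure (pair_pmf M N) (A \<times> B) = (\<integral>\<^sup>+x. indicator (A \<times> B) x \<partial>pair_pmf M N)"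
    by simp
  also have "\<dots> = (\<integral>\<^sup>+a. \<integral>\<^sup>+b. indicator A a * indicator B b \<partial>N \<partial>M)"
    by (subst nn_integral_pair_pmf') (simp add: indicator_times)
  also have "\<dots> = emeasure M A * emeasure N B"
    by (simp add: nn_integral_cmult nn_integral_multc)
  finally show ?thesis
    by (simp add: measure_def enn2real_mult)
qed

text \<open>
  Events are predicates here, and \<open>F\<close> depending only on the coordinates in \<open>A\<close> is expressed
  by invariance under changes outside \<open>A\<close>. The product splits into the factors over \<open>A\<close> and over
  \<open>I - A\<close>, and the two events restrict one factor each.
\<close>

lemma prob_Pi_pmf_disjoint_coordinates:
  fixes p :: "'a \<Rightarrow> 'b pmf" and F G :: "('a \<Rightarrow> 'b) \<Rightarrow> bool" and d :: 'b
  assumes "finite I" "A \<inter> B = {}"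
  assumes F: "\<And>f g. (\<And>x. x \<in> A \<Longrightarrow> f x = g x) \<Longrightarrow> F f \<Longrightarrow> F g"
      and G: "\<And>f g. (\<And>x. x \<in> B \<Longrightarrow> f x = g x) \<Longrightarrow> G f \<Longrightarrow> G g"
      and I: "A \<subseteq> I"
  defines "\<Omega> \<equiv> Pi_pmf I d p"
  shows "measure_pmf.prob \<Omega> {f. F f \<and> G f} =
         measure_pmf.prob \<Omega> {f. F f} * measure_pmf.prob \<Omega> {f. G f}"
proof -
  define h where "h = (\<lambda>(f :: 'a \<Rightarrow> 'b, g :: 'a \<Rightarrow> 'b) x. if x \<in> A then f x else g x)"
  define M where "M = Pi_pmf A d p"
  define N where "N = Pi_pmf (I - A) d p"
  have \<Omega>: "\<Omega> = map_pmf h (pair_pmf M N)"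
  proof -
    have "finite A" using I assms(1) by (rule finite_subset)
    moreover have "A \<union> (I - A) = I" using I by auto
    ultimately show ?thesis
      using Pi_pmf_union[of A "I - A" d p] assms(1)
      by (simp add: \<Omega>_def M_def N_def h_def)
  qed
  have F': "F (h (f, g)) \<longleftrightarrow> F f" for f g
    using F[of f "h (f, g)"] F[of "h (f, g)" f] by (auto simp: h_def)
  have G': "G (h (f, g)) \<longleftrightarrow> G g" for f g
  proof -
    have "h (f, g) x = g x" if "x \<in> B" for x using that assms(2) by (auto simp: h_def)
    then show ?thesis using G[of g "h (f, g)"] G[of "h (f, g)" g] by auto
  qed
  have "h -` {f. F f \<and> G f} = {f. F f} \<times> {g. G g}"
       "h -` {f. F f} = {f. F f} \<times> UNIV" "h -` {f. G f} = UNIV \<times> {g. G g}"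
    by (auto simp: F' G')
  then show ?thesis
    by (simp add: \<Omega> prob_pair_pmf_Times)
qed

text \<open>
  The sum of \<open>pmf D x ^ k\<close> over all \<open>x\<close>, for \<open>k \<ge> 1\<close>: the probability that \<open>k\<close> independent samples
  of \<open>D\<close> agree. Taking the expectation over the first sample avoids an infinite sum.
\<close>

definition coincidence :: "'a pmf \<Rightarrow> nat \<Rightarrow> real" where
  "coincidence D k = measure_pmf.expectation D (\<lambda>x. pmf D x ^ (k - 1))"

text \<open>
  Condition on the value \<open>y\<close> at \<open>b\<close>: each of the other \<open>card B - 1\<close> coordinates then
  independently has probability \<open>pmf D y\<close> of being equal to it.
\<close>

lemma prob_constant_on:
  assumes "finite I" "B \<subseteq> I" "b \<in> B"
  shows "measure_pmf.prob (Pi_pmf I d (\<lambda>_. D)) {c. \<forall>j\<in>B. c j = c b} = coincidence D (card B)"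
proof -
  have fin: "finite (I - {b})" "finite B" using assms finite_subset by auto
  have card: "card (B - {b}) = card B - 1" using assms by simp
  have I: "insert b (I - {b}) = I" using assms by auto
  let ?N = "Pi_pmf (I - {b}) d (\<lambda>_. D)"
  have *: "measure_pmf.prob ?N {f. \<forall>j\<in>B. (f(b := y)) j = y} = pmf D y ^ (card B - 1)" for y
  proof -
    have "{f. \<forall>j\<in>B. (f(b := y)) j = y} = Pi (I - {b}) (\<lambda>j. if j \<in> B - {b} then {y} else UNIV)"
      using assms by (auto simp: Pi_def split: if_splits)
    then have "measure_pmf.prob ?N {f. \<forall>j\<in>B. (f(b := y)) j = y}
        = (\<Prod>j\<in>I - {b}. measure_pmf.prob D (if j \<in> B - {b} then {y} else UNIV))"
      using fin by (simp only: measure_Pi_pmf_Pi)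
    also have "\<dots> = (\<Prod>j\<in>B - {b}. pmf D y)"
      by (rule prod.mono_neutral_cong_right) (use assms fin in \<open>auto simp: pmf.rep_eq\<close>)
    finally show ?thesis using card by simp
  qed
  have "measure_pmf.prob (Pi_pmf I d (\<lambda>_. D)) {c. \<forall>j\<in>B. c j = c b}
      = measure_pmf.prob (D \<bind> (\<lambda>y. map_pmf (\<lambda>f. f(b := y)) ?N)) {c. \<forall>j\<in>B. c j = c b}"
    using Pi_pmf_insert'[OF fin(1), of b d "\<lambda>_. D"] unfolding I by (simp add: map_pmf_def)
  also have "\<dots> = measure_pmf.expectation D
      (\<lambda>y. measure_pmf.prob (map_pmf (\<lambda>f. f(b := y)) ?N) {c. \<forall>j\<in>B. c j = c b})"
    unfolding measure_pmf_bind
    by (subst measure_pmf.measure_bind[where N = "count_space UNIV"])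
       (auto simp: measure_pmf_in_subprob_space)
  also have "\<dots> = coincidence D (card B)"
    unfolding coincidence_def using * by (simp add: vimage_def)
  finally show ?thesis .
qed

lemma integrable_pmf_power: "integrable (measure_pmf D) (\<lambda>x. pmf D x ^ j)"
  by (rule measure_pmf.integrable_const_bound[where B = 1]) (auto intro!: power_le_one pmf_le_1)

lemma coincidence_bounds: "0 \<le> coincidence D k" "coincidence D k \<le> 1"
proof -
  show "0 \<le> coincidence D k" unfolding coincidence_def by (intro Bochner_Integration.integral_nonneg) auto
  have "coincidence D k \<le> measure_pmf.expectation D (\<lambda>_. 1)" unfolding coincidence_def
    by (rule Bochner_Integration.integral_mono[OF integrable_pmf_power]) (auto intro!: power_le_one pmf_le_1)
  then show "coincidence D k \<le> 1" by simp
qed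

text \<open>
  This bounds the cost of one more coinciding term, which makes overlapping runs rare.
\<close>

lemma coincidence_Suc_le:
  assumes "\<And>x. pmf D x \<le> M" "k \<ge> 1"
  shows "coincidence D (Suc k) \<le> M * coincidence D k"
proof -
  have "coincidence D (Suc k) \<le> measure_pmf.expectation D (\<lambda>x. M * pmf D x ^ (k - 1))"
    unfolding coincidence_def
    by (rule Bochner_Integration.integral_mono[OF integrable_pmf_power])
       (use assms in \<open>auto intro!: integrable_pmf_power mult_right_mono simp: power_eq_if[of _ k]\<close>)
  then show ?thesis by (simp add: coincidence_def)
qed

section \<open>Where a run can end\<close>

lemma contains_run_mono: "contains_run m k c \<Longrightarrow> m \<le> n \<Longrightarrow> contains_run n k c"
  unfolding contains_run_def by (meson atLeastatMost_subset_iff order.refl subset_trans)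

lemma contains_run_cong:
  assumes "\<And>i. i \<in> {1..n} \<Longrightarrow> c i = c' i" "k \<ge> 1" "contains_run n k c"
  shows "contains_run n k c'"
proof -
  from assms(3) obtain i where i: "{i..<i+k} \<subseteq> {1..n}" "\<forall>j\<in>{i..<i+k}. c j = c i"
    unfolding contains_run_def by blast
  have "i \<in> {i..<i+k}" using assms(2) by simp
  then have "\<forall>j\<in>{i..<i+k}. c' j = c' i" using i assms(1) by (metis subsetD)
  then show ?thesis using i unfolding contains_run_def by blast
qed

lemma contains_run_too_short:
  assumes "n < k"
  shows "\<not> contains_run n k c"
proof
  assume "contains_run n k c"
  then obtain i where "{i..<i+k} \<subseteq> {1..n}" unfolding contains_run_def by blast
  then have "card {i..<i+k} \<le> card {1..n}" by (intro card_mono) auto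
  then show False using assms by simp
qed

definition run_from :: "nat \<Rightarrow> nat \<Rightarrow> (nat \<Rightarrow> nat) \<Rightarrow> bool" where
  "run_from i k c \<longleftrightarrow> (\<forall>j\<in>{i..<i + k}. c j = c i)"

lemma contains_run_iff_run_from:
  "contains_run n k c \<longleftrightarrow> (\<exists>i. {i..<i + k} \<subseteq> {1..n} \<and> run_from i k c)"
  unfolding contains_run_def run_from_def ..

lemma run_fromD: "run_from i k c \<Longrightarrow> j \<in> {i..<i + k} \<Longrightarrow> c j = c i"
  unfolding run_from_def by blast

lemma contains_run_last:
  assumes "k \<ge> 1"
  shows "contains_run (s + k) k c \<longleftrightarrow> contains_run (s + k - 1) k c \<or> run_from (Suc s) k c"
proof
  assume "contains_run (s + k) k c"
  then obtain i where i: "{i..<i+k} \<subseteq> {1..s+k}" "run_from i k c"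
    unfolding contains_run_iff_run_from by blast
  have "i \<in> {i..<i+k}" "i + k - 1 \<in> {i..<i+k}" using assms by auto
  then have "1 \<le> i" "i \<le> Suc s" using i(1) assms by force+
  show "contains_run (s + k - 1) k c \<or> run_from (Suc s) k c"
  proof (cases "i = Suc s")
    case False
    then have "{i..<i+k} \<subseteq> {1..s+k-1}" using \<open>1 \<le> i\<close> \<open>i \<le> Suc s\<close> by auto
    then show ?thesis using i(2) unfolding contains_run_iff_run_from by blast
  qed (use i(2) in simp)
next
  assume "contains_run (s + k - 1) k c \<or> run_from (Suc s) k c"
  then show "contains_run (s + k) k c"
  proof
    assume "run_from (Suc s) k c"
    moreover have "{Suc s..<Suc s + k} \<subseteq> {1..s + k}" by auto
    ultimately show ?thesis unfolding contains_run_iff_run_from by blast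
  qed (rule contains_run_mono[OF _ diff_le_self])
qed

text \<open>
  A run that fits neither before position \<open>s + 1\<close> nor uses position \<open>s + k\<close> must straddle the
  border between \<open>s\<close> and \<open>s + 1\<close>, so both of these positions belong to it. This is what couples
  the last window to the past.
\<close>

lemma contains_run_crossing:
  assumes "contains_run (s + k - 1) k c" "\<not> contains_run s k c" "k \<ge> 1"
  shows "s \<ge> 1 \<and> c s = c (Suc s)"
proof -
  from assms(1) obtain i where i: "{i..<i+k} \<subseteq> {1..s+k-1}" "run_from i k c"
    unfolding contains_run_iff_run_from by blast
  have "i \<in> {i..<i+k}" "i + k - 1 \<in> {i..<i+k}" using assms by auto
  then have b: "1 \<le> i" "i \<le> s" using i(1) assms(3) by force+
  have "\<not> {i..<i+k} \<subseteq> {1..s}" using assms(2) i(2) unfolding contains_run_iff_run_from by blast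
  then have "s + 1 < i + k" using b by (auto simp: subset_iff)
  then have "s \<in> {i..<i+k}" "Suc s \<in> {i..<i+k}" using b by auto
  then show ?thesis using run_fromD[OF i(2)] b by (metis order_trans)
qed

section \<open>The probability of having no run\<close>

text \<open>
  The bound does not grow with \<open>n\<close>: an error of \<open>(M + k * r) * r\<close> per step is exactly what the
  contraction by \<open>1 - r\<close> absorbs, since \<open>(1 - r) * C + C * r = C\<close>.
\<close>

lemma prob_no_run_approx:
  fixes D :: "nat pmf"
  assumes M: "\<And>x. pmf D x \<le> M" and k: "k \<ge> 1"
  defines "r \<equiv> coincidence D k"
  shows "\<bar>measure_pmf.prob (Pi_pmf {1..n} d (\<lambda>_. D)) {c. \<not> contains_run n k c} - (1 - r) ^ n\<bar>
           \<le> M + k * r"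
proof -
  define \<Omega> where "\<Omega> = Pi_pmf {1..n} d (\<lambda>_. D)"
  define u where "u m = measure_pmf.prob \<Omega> {c. \<not> contains_run m k c}" for m
  have r: "0 \<le> r" "r \<le> 1" unfolding r_def by (rule coincidence_bounds)+
  have "0 \<le> M" using M[of 0] pmf_nonneg[of D 0] by linarith
  have mono: "measure_pmf.prob \<Omega> A \<le> measure_pmf.prob \<Omega> B" if "A \<subseteq> B" for A B
    using that by (intro measure_pmf.finite_measure_mono) auto
  have u1: "u m \<le> 1" for m unfolding u_def by simp
  have u_short: "u m = 1" if "m < k" for m
    unfolding u_def using that contains_run_too_short by simp
  \<comment> \<open>the probability that the first run occupies exactly the positions \<open>s + 1, \<dots>, s + k\<close>\<close>
  define step where "step s = measure_pmf.prob \<Omega> {c. \<not> contains_run (s + k - 1) k c \<and> run_from (Suc s) k c}" for s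
  have u_step: "u (s + k - 1) = u (s + k) + step s" for s
  proof -
    have "{c. \<not> contains_run (s + k - 1) k c} = {c. \<not> contains_run (s + k) k c} \<union>
       {c. \<not> contains_run (s + k - 1) k c \<and> run_from (Suc s) k c}"
      using contains_run_last[OF k, of s] by auto
    then have "u (s + k - 1) = measure_pmf.prob \<Omega> ({c. \<not> contains_run (s + k) k c} \<union>
       {c. \<not> contains_run (s + k - 1) k c \<and> run_from (Suc s) k c})" by (simp only: u_def)
    also have "\<dots> = u (s + k) + step s" unfolding u_def step_def
      by (rule measure_pmf.finite_measure_Union) (use contains_run_last[OF k, of s] in auto)
    finally show ?thesis .
  qed
  have indep: "measure_pmf.prob \<Omega> {c. \<not> contains_run s k c \<and> run_from (Suc s) k c} = u s * r"
    if "s + k \<le> n" for s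
  proof -
    have "measure_pmf.prob \<Omega> {c. \<not> contains_run s k c \<and> run_from (Suc s) k c}
        = u s * measure_pmf.prob \<Omega> {c. run_from (Suc s) k c}"
      unfolding \<Omega>_def u_def
    proof (rule prob_Pi_pmf_disjoint_coordinates[where A = "{1..s}" and B = "{Suc s..<Suc s + k}"])
      fix f g assume fg: "\<And>x. x \<in> {1..s} \<Longrightarrow> f x = g x" and "\<not> contains_run s k f"
      then show "\<not> contains_run s k g"
        using contains_run_cong[of s g f k] k by (metis fg)
    next
      fix f g assume fg: "\<And>x. x \<in> {Suc s..<Suc s + k} \<Longrightarrow> f x = g x" and "run_from (Suc s) k f"
      moreover have "Suc s \<in> {Suc s..<Suc s + k}" using k by simp
      ultimately show "run_from (Suc s) k g" unfolding run_from_def by metis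
    qed (use that k in auto)
    also have "measure_pmf.prob \<Omega> {c. run_from (Suc s) k c} = r"
      unfolding \<Omega>_def r_def run_from_def
      by (subst prob_constant_on) (use that k in auto)
    finally show ?thesis .
  qed
  \<comment> \<open>Absence of runs among the first \<open>s + k - 1\<close> terms is relaxed to the first \<open>s\<close> terms, which are
    disjoint from the window.\<close>
  have upper: "step s \<le> u s * r" if "s + k \<le> n" for s
    unfolding step_def indep[OF that, symmetric]
    by (rule mono) (use contains_run_mono[of s k _ "s + k - 1"] k in auto)
  \<comment> \<open>The relaxation loses only configurations in which term \<open>s\<close> agrees with the whole window.\<close>
  have lower: "u s * r \<le> step s + M * r" if "s + k \<le> n" for s
  proof (cases "s \<ge> 1")
    case True
    have "u s * r \<le> measure_pmf.prob \<Omega>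
        ({c. \<not> contains_run (s + k - 1) k c \<and> run_from (Suc s) k c} \<union> {c. run_from s (Suc k) c})"
      unfolding indep[OF that, symmetric]
    proof (rule mono, safe)
      fix c assume c: "\<not> contains_run s k c" "run_from (Suc s) k c"
        and new: "\<not> run_from s (Suc k) c" and run: "contains_run (s + k - 1) k c"
      have "c s = c (Suc s)" using contains_run_crossing[OF run c(1) k] by simp
      moreover have "j = s \<or> j \<in> {Suc s..<Suc s + k}" if "j \<in> {s..<s + Suc k}" for j
        using that by auto
      ultimately have "run_from s (Suc k) c"
        using run_fromD[OF c(2)] unfolding run_from_def by metis
      with new show False ..
    qed
    also have "\<dots> \<le> step s + measure_pmf.prob \<Omega> {c. run_from s (Suc k) c}"
      unfolding step_def by (rule measure_Un_le) auto
    also have "measure_pmf.prob \<Omega> {c. run_from s (Suc k) c} = coincidence D (Suc k)"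
      unfolding \<Omega>_def run_from_def by (subst prob_constant_on) (use that k True in auto)
    also have "\<dots> \<le> M * r" unfolding r_def by (rule coincidence_Suc_le[OF M k])
    finally show ?thesis by simp
  next
    case False
    have "u s * r \<le> step s"
      unfolding indep[OF that, symmetric] step_def
      by (rule mono) (use contains_run_crossing[of s k] False k in auto)
    then show ?thesis using \<open>0 \<le> M\<close> r(1) by (simp add: add_increasing2)
  qed
  \<comment> \<open>The recursion delivers \<open>u s\<close>, but \<open>u (s + k - 1)\<close> is wanted; the two differ by at most
    \<open>k - 1\<close> steps, each a drop of at most \<open>r\<close>.\<close>
  have one_step: "u m \<le> u (Suc m) + r" if "Suc m \<le> n" for m
  proof (cases "Suc m < k")
    case True
    then show ?thesis using u_short[of m] u_short[of "Suc m"] r by simp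
  next
    case False
    define s where "s = Suc m - k"
    have s: "s + k = Suc m" "s + k - 1 = m" using False by (auto simp: s_def)
    have "step s \<le> 1 * r"
      using upper[of s] that s u1[of s] r mult_right_mono[of "u s" 1 r] by linarith
    then show ?thesis using u_step[of s] unfolding s by simp
  qed
  have many_steps: "u s \<le> u (s + j) + j * r" if "s + j \<le> n" for s j
    using that
  proof (induction j)
    case (Suc j)
    then show ?case using one_step[of "s + j"] by (simp add: algebra_simps)
  qed simp
  have "\<bar>u m - (1 - r) ^ m\<bar> \<le> M + k * r" if "m \<le> n" for m
    using that
  proof (induction m)
    case 0
    then show ?case using u_short[of 0] k r \<open>0 \<le> M\<close> by simp
  next
    case (Suc m)
    show ?case
    proof (cases "Suc m < k")
      case True
      \<comment> \<open>Fewer than \<open>k\<close> terms hold no run, and \<open>(1 - r) ^ Suc m\<close> is within \<open>k * r\<close> of 1.\<close>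
      have "1 + real (Suc m) * (- r) \<le> (1 + (- r)) ^ Suc m"
        by (rule Bernoulli_inequality) (use r in simp)
      moreover have "(1 - r) ^ Suc m \<le> 1" using r by (intro power_le_one) auto
      moreover have "real (Suc m) * r \<le> k * r" using True r by (intro mult_right_mono) auto
      ultimately show ?thesis using u_short[OF True] \<open>0 \<le> M\<close> by (simp del: of_nat_Suc power_Suc)
    next
      case False
      define s where "s = Suc m - k"
      have s: "s + k = Suc m" "s + k - 1 = m" "s + (k - 1) = m"
        using False k by (auto simp: s_def)
      define e where "e = u (Suc m) - (1 - r) * u m"
      have e: "e = r * (u m - u s) + (u s * r - step s)"
        using u_step[of s] unfolding s e_def by (simp add: algebra_simps)
      have us: "u s - u m \<le> (k - 1) * r" using many_steps[of s "k - 1"] s Suc.prems by simp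
      have su: "u m \<le> u s" unfolding u_def
        by (rule mono) (use contains_run_mono[of s k _ m] s in auto)
      have "r * (u s - u m) \<le> r * (k * r)"
        using us r(1) k by (intro mult_left_mono order_trans[OF us] mult_right_mono) auto
      moreover have "0 \<le> r * (u s - u m)" using su r by simp
      moreover have "r * (u m - u s) = - (r * (u s - u m))" by (simp add: algebra_simps)
      moreover have "0 \<le> u s * r - step s" "u s * r - step s \<le> M * r"
        using upper[of s] lower[of s] s Suc.prems by auto
      moreover have "0 \<le> r * (k * r)" "0 \<le> M * r" using r \<open>0 \<le> M\<close> by auto
      ultimately have e_le: "\<bar>e\<bar> \<le> (M + k * r) * r" unfolding e by (simp add: algebra_simps abs_le_iff)
      have "u (Suc m) - (1 - r) ^ Suc m = (1 - r) * (u m - (1 - r) ^ m) + e"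
        by (simp add: e_def algebra_simps)
      then have "\<bar>u (Suc m) - (1 - r) ^ Suc m\<bar> \<le> (1 - r) * \<bar>u m - (1 - r) ^ m\<bar> + \<bar>e\<bar>"
        using r by (metis abs_mult abs_of_nonneg abs_triangle_ineq diff_ge_0_iff_ge)
      also have "\<dots> \<le> (1 - r) * (M + k * r) + (M + k * r) * r"
        using Suc r e_le by (intro add_mono mult_left_mono) auto
      finally show ?thesis by (simp add: algebra_simps)
    qed
  qed
  from this[of n] show ?thesis by (simp add: u_def \<Omega>_def)
qed


section \<open>Geometric terms and the three regimes\<close>

lemma coincidence_geometric:
  assumes "q \<in> {0<..1}" "k \<ge> 1"
  shows "coincidence (geometric_pmf q) k = q ^ (k - 1) / (\<Sum>i<k. (1 - q) ^ i)"
proof -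
  have k: "k = Suc (k - 1)" using assms by simp
  have power_k: "x ^ k = x * x ^ (k - 1)" for x :: real by (subst k) simp
  have "(1 - q) ^ k \<le> (1 - q) ^ 1" using assms by (intro power_decreasing) auto
  then have lt: "(1 - q) ^ k < 1" using assms by simp
  have sums: "(\<lambda>j. q ^ k * ((1 - q) ^ k) ^ j) sums (q ^ k * (1 / (1 - (1 - q) ^ k)))"
    using lt assms by (intro sums_mult geometric_sums) auto
  have pmf_eq: "pmf (geometric_pmf q) j * pmf (geometric_pmf q) j ^ (k - 1)
      = q ^ k * ((1 - q) ^ k) ^ j" for j
    using assms by (subst power_k[symmetric]) (simp add: power_mult_distrib mult.commute flip: power_mult)
  have "coincidence (geometric_pmf q) k
      = (\<integral>j. pmf (geometric_pmf q) j * pmf (geometric_pmf q) j ^ (k - 1) \<partial>count_space UNIV)"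
    unfolding coincidence_def by (subst measure_pmf_eq_density, subst integral_density) auto
  also have "\<dots> = (\<Sum>j. q ^ k * ((1 - q) ^ k) ^ j)"
    unfolding pmf_eq using sums assms
    by (intro integral_count_space_nat) (auto simp: integrable_count_space_nat_iff sums_iff)
  also have "\<dots> = q ^ k / (1 - (1 - q) ^ k)" using sums by (simp add: sums_iff)
  also have "1 - (1 - q) ^ k = q * (\<Sum>i<k. (1 - q) ^ i)"
    unfolding one_diff_power_eq by simp
  also have "q ^ k / (q * (\<Sum>i<k. (1 - q) ^ i)) = q ^ (k - 1) / (\<Sum>i<k. (1 - q) ^ i)"
    unfolding power_k using assms(1) by (intro nonzero_mult_divide_mult_cancel_left) simp
  finally show ?thesis .
qed

lemma power_one_minus_tendsto:
  fixes r :: "nat \<Rightarrow> real"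
  assumes r0: "r \<longlonglongrightarrow> 0" and L: "(\<lambda>n. real n * r n) \<longlonglongrightarrow> L"
  shows "(\<lambda>n. (1 - r n) ^ n) \<longlonglongrightarrow> exp (- L)"
proof (rule tendsto_sandwich)
  have small: "eventually (\<lambda>n. r n < 1) sequentially"
    using r0 by (rule order_tendstoD) simp
  have lower: "exp (- (x / (1 - x))) \<le> 1 - x" if "x < 1" for x :: real
  proof -
    have "1 / (1 - x) \<le> exp (x / (1 - x))"
      using exp_ge_add_one_self[of "x / (1 - x)"] that by (simp add: field_simps)
    then show ?thesis using that by (simp add: exp_minus field_simps)
  qed
  show "\<forall>\<^sub>F n in sequentially. exp (- (n * r n / (1 - r n))) \<le> (1 - r n) ^ n"
    using small
  proof eventually_elim
    case (elim n)
    have "exp (- (r n / (1 - r n))) ^ n \<le> (1 - r n) ^ n"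
      by (intro power_mono lower elim) simp
    then show ?case by (simp flip: exp_of_nat_mult)
  qed
  show "\<forall>\<^sub>F n in sequentially. (1 - r n) ^ n \<le> exp (- (n * r n))"
    using small
  proof eventually_elim
    case (elim n)
    have "(1 - r n) ^ n \<le> exp (- r n) ^ n"
      by (intro power_mono exp_minus_ge) (use elim in simp)
    then show ?case by (simp flip: exp_of_nat_mult)
  qed
  have "(\<lambda>n. exp (- (real n * r n / (1 - r n)))) \<longlonglongrightarrow> exp (- (L / (1 - 0)))"
    by (intro tendsto_intros r0 L) simp
  then show "(\<lambda>n. exp (- (real n * r n / (1 - r n)))) \<longlonglongrightarrow> exp (- L)" by simp
  show "(\<lambda>n. exp (- (real n * r n))) \<longlonglongrightarrow> exp (- L)"
    by (intro tendsto_intros L)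
qed

theorem proposition4p21:
  fixes k :: nat and \<alpha> :: real and p q :: "nat \<Rightarrow> real"
  defines "P \<equiv> \<lambda>n. measure_pmf.prob (geometric_composition n (p n)) {c. contains_run n k c}"
    and "thr \<equiv> \<lambda>n. real n powr (- 1 / (real k - 1))"
  assumes "k \<ge> 2" and "\<alpha> > 0"
    and "\<And>n. n \<ge> 1 \<Longrightarrow> p n \<in> {0..<1}" and "\<And>n. n \<ge> 1 \<Longrightarrow> q n = 1 - p n"
  shows "(asymp_less q (\<lambda>_. 1) \<and> asymp_less thr q \<longrightarrow> P \<longlonglongrightarrow> 1) \<and>
         (asymp_sim q (\<lambda>n. \<alpha> * thr n) \<longrightarrow> P \<longlonglongrightarrow> 1 - exp (- (\<alpha> ^ (k - 1) / real k))) \<and>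
         (asymp_less q thr \<longrightarrow> P \<longlonglongrightarrow> 0)"
proof -
  note k = \<open>k \<ge> 2\<close> and \<alpha> = \<open>\<alpha> > 0\<close> and p = assms(5) and q = assms(6)
  have k1: "k \<ge> 1" "k - 1 \<noteq> 0" using k by auto
  have q_range: "q n \<in> {0<..1}" if "n \<ge> 1" for n using p[OF that] q[OF that] by auto
  define S where "S n = (\<Sum>i<k. (1 - q n) ^ i)" for n
  define r where "r n = q n ^ (k - 1) / S n" for n
  have S1: "1 \<le> S n" and Sk: "S n \<le> k" if "n \<ge> 1" for n
  proof -
    have "(1 - q n) ^ 0 \<le> S n" unfolding S_def
      by (rule member_le_sum) (use q_range[OF that] k in auto)
    then show "1 \<le> S n" by simp
    have "S n \<le> (\<Sum>i<k. 1)" unfolding S_def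
      using q_range[OF that] by (intro sum_mono power_le_one) auto
    then show "S n \<le> k" by simp
  qed
  have r: "coincidence (geometric_pmf (q n)) k = r n" if "n \<ge> 1" for n
    unfolding r_def S_def by (rule coincidence_geometric[OF q_range[OF that] k1(1)])
  have r_le: "r n \<le> q n" and r_nonneg: "0 \<le> r n" if "n \<ge> 1" for n
  proof -
    have "r n \<le> q n ^ (k - 1) / 1" unfolding r_def
      using S1[OF that] q_range[OF that] by (intro divide_left_mono) auto
    also have "\<dots> \<le> q n ^ 1 / 1" using q_range[OF that] k
      by (intro divide_right_mono power_decreasing) auto
    finally show "r n \<le> q n" by simp
    show "0 \<le> r n" unfolding r[OF that, symmetric] by (rule coincidence_bounds)
  qed
  have error: "\<bar>(1 - P n) - (1 - r n) ^ n\<bar> \<le> (k + 1) * q n" if "n \<ge> 1" for n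
  proof -
    have "pmf (geometric_pmf (q n)) j \<le> q n" for j
      using q_range[OF that] by (auto intro!: mult_left_le_one_le power_le_one)
    from prob_no_run_approx[OF this k1(1), of n 0]
    have "\<bar>measure_pmf.prob (geometric_composition n (p n)) {c. \<not> contains_run n k c} - (1 - r n) ^ n\<bar>
        \<le> q n + k * r n"
      unfolding geometric_composition_def q[OF that, symmetric] r[OF that] .
    moreover have "measure_pmf.prob (geometric_composition n (p n)) {c. \<not> contains_run n k c} = 1 - P n"
      unfolding P_def by (subst measure_pmf.prob_compl[symmetric]) (auto intro: arg_cong[where f = "measure_pmf.prob _"])
    moreover have "k * r n \<le> k * q n" using r_le[OF that] by (intro mult_left_mono) auto
    ultimately show ?thesis by (simp add: algebra_simps)
  qed
  have reduce: "P \<longlonglongrightarrow> 1 - L" if q0: "q \<longlonglongrightarrow> 0" and L: "(\<lambda>n. (1 - r n) ^ n) \<longlonglongrightarrow> L" for L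
  proof -
    have "(\<lambda>n. real (k + 1) * q n) \<longlonglongrightarrow> 0" by (rule tendsto_mult_right_zero[OF q0])
    moreover have "\<forall>\<^sub>F n in sequentially. norm ((1 - P n) - (1 - r n) ^ n) \<le> real (k + 1) * q n"
      unfolding real_norm_def using error by (rule eventually_sequentiallyI)
    ultimately have "(\<lambda>n. (1 - P n) - (1 - r n) ^ n) \<longlonglongrightarrow> 0"
      by (rule Lim_null_comparison[rotated])
    from tendsto_diff[OF tendsto_const[of 1] tendsto_add[OF this L]] show ?thesis by simp
  qed
  have thr_pos: "thr n > 0" if "n \<ge> 1" for n using that by (simp add: thr_def)
  \<comment> \<open>The threshold is the value of \<open>q\<close> at which \<open>n * q ^ (k - 1) = 1\<close>.\<close>
  have nq: "n * q n ^ (k - 1) = (q n / thr n) ^ (k - 1)" if "n \<ge> 1" for n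
  proof -
    have "thr n ^ (k - 1) = thr n powr (real (k - 1))"
      using thr_pos[OF that] by (simp add: powr_realpow)
    also have "\<dots> = real n powr ((- 1 / (real k - 1)) * (real k - 1))"
      unfolding thr_def powr_powr using k by (simp add: of_nat_diff)
    also have "\<dots> = 1 / n" using k that by (simp add: powr_minus_divide)
    finally show ?thesis by (simp add: power_divide)
  qed
  have nr: "n * r n = (q n / thr n) ^ (k - 1) / S n" if "n \<ge> 1" for n
    using nq[OF that] by (simp add: r_def)
  have thr0: "thr \<longlonglongrightarrow> 0"
    unfolding thr_def using k by (intro tendsto_neg_powr filterlim_real_sequentially) auto
  \<comment> \<open>Both the critical and the sparse regime: the latter is \<open>\<beta> = 0\<close>, where \<open>\<beta> ^ (k - 1) = 0\<close>
    because \<open>k \<ge> 2\<close>.\<close>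
  have critical: "P \<longlonglongrightarrow> 1 - exp (- (\<beta> ^ (k - 1) / real k))" if \<beta>: "(\<lambda>n. q n / thr n) \<longlonglongrightarrow> \<beta>" for \<beta>
  proof -
    have "(\<lambda>n. q n / thr n * thr n) \<longlonglongrightarrow> 0"
      using tendsto_mult[OF \<beta> thr0] by simp
    then have q0: "q \<longlonglongrightarrow> 0"
      by (rule Lim_transform_eventually)
         (use thr_pos in \<open>auto intro!: eventually_sequentiallyI[of 1] simp: less_imp_neq[THEN not_sym]\<close>)
    have "S \<longlonglongrightarrow> (\<Sum>i<k. (1 - 0) ^ i)" unfolding S_def by (intro tendsto_intros q0)
    then have S: "S \<longlonglongrightarrow> k" by simp
    have "(\<lambda>n. (q n / thr n) ^ (k - 1) / S n) \<longlonglongrightarrow> \<beta> ^ (k - 1) / k"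
      by (intro tendsto_intros \<beta> S) (use k in simp)
    then have nr_lim: "(\<lambda>n. n * r n) \<longlonglongrightarrow> \<beta> ^ (k - 1) / k"
      by (rule Lim_transform_eventually) (auto intro!: eventually_sequentiallyI[of 1] simp: nr)
    have "r \<longlonglongrightarrow> 0"
      using r_le r_nonneg q0 by (intro tendsto_sandwich[OF _ _ tendsto_const q0])
        (auto intro!: eventually_sequentiallyI[of 1])
    from reduce[OF q0 power_one_minus_tendsto[OF this nr_lim]] show ?thesis .
  qed
  have "P \<longlonglongrightarrow> 1" if q0: "q \<longlonglongrightarrow> 0" and large: "(\<lambda>n. thr n / q n) \<longlonglongrightarrow> 0"
  proof -
    have "filterlim (\<lambda>n. inverse (thr n / q n)) at_top sequentially"
      by (rule filterlim_inverse_at_top[OF large])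
         (use thr_pos q_range in \<open>auto intro!: eventually_sequentiallyI[of 1]\<close>)
    then have "filterlim (\<lambda>n. (q n / thr n) ^ (k - 1)) at_top sequentially"
      using k by (intro filterlim_pow_at_top) auto
    then have "filterlim (\<lambda>n. 1 / k * (q n / thr n) ^ (k - 1)) at_top sequentially"
      using k by (intro filterlim_tendsto_pos_mult_at_top[OF tendsto_const]) auto
    then have nr_top: "filterlim (\<lambda>n. n * r n) at_top sequentially"
    proof (rule filterlim_at_top_mono)
      show "\<forall>\<^sub>F n in sequentially. 1 / k * (q n / thr n) ^ (k - 1) \<le> n * r n"
        using eventually_ge_at_top[of 1]
      proof eventually_elim
        case (elim n)
        have "(q n / thr n) ^ (k - 1) / k \<le> (q n / thr n) ^ (k - 1) / S n"
          using S1[OF elim] Sk[OF elim] q_range[OF elim] thr_pos[OF elim] k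
          by (intro divide_left_mono) auto
        then show ?case using nr[OF elim] by simp
      qed
    qed
    have "(\<lambda>n. (1 - r n) ^ n) \<longlonglongrightarrow> 0"
    proof (rule Lim_null_comparison)
      show "\<forall>\<^sub>F n in sequentially. norm ((1 - r n) ^ n) \<le> exp (- (n * r n))"
        using eventually_ge_at_top[of 1]
      proof eventually_elim
        case (elim n)
        have "r n \<le> 1" using r_le[OF elim] q_range[OF elim] by simp
        then have "\<bar>1 - r n\<bar> ^ n \<le> exp (- r n) ^ n"
          using exp_minus_ge[of "r n"] by (intro power_mono) auto
        then show ?case by (simp add: power_abs flip: exp_of_nat_mult)
      qed
      show "(\<lambda>n. exp (- (n * r n))) \<longlonglongrightarrow> 0"
        by (intro filterlim_compose[OF exp_at_bot] filterlim_compose[OF filterlim_uminus_at_bot_at_top] nr_top)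
    qed
    from reduce[OF q0 this] show ?thesis by simp
  qed
  moreover have "P \<longlonglongrightarrow> 1 - exp (- (\<alpha> ^ (k - 1) / real k))"
    if "(\<lambda>n. q n / (\<alpha> * thr n)) \<longlonglongrightarrow> 1"
  proof (rule critical)
    have "(\<lambda>n. \<alpha> * (q n / (\<alpha> * thr n))) \<longlonglongrightarrow> \<alpha> * 1" by (intro tendsto_intros that)
    then show "(\<lambda>n. q n / thr n) \<longlonglongrightarrow> \<alpha>" using \<alpha> by simp
  qed
  moreover have "P \<longlonglongrightarrow> 0" if "(\<lambda>n. q n / thr n) \<longlonglongrightarrow> 0"
    using critical[OF that] k1(2) by (simp add: power_0_left)
  ultimately show ?thesis by (auto simp: asymp_less_def asymp_sim_def)
qed

end
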